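(* Let $Z$ be a Banach space over $\mathbb{K}$ and let $u\in S_Z$ be a vertex of $Z$. If $z\in Z$ is a smooth point of the normed space $(Z,v_u)$, then $z\not\perp_B^{v_u}u$, that is, $z$ is not Birkhoff-James orthogonal to $u$ in $(Z,v_u)$.
   Context: $\mathbb{K}$ is $\mathbb{R}$ or $\mathbb{C}$. $S_Z$ and $S_{Z^*}$ are the unit spheres of $Z$ and $Z^*$. For $u\in S_Z$, the numerical radius with respect to $u$ is the seminorm $v_u(z):=\sup\{|\phi(z)|\colon\phi\in S_{Z^*},\ \phi(u)=1\}$ for $z\in Z$; $u$ is a vertex of $Z$ if $v_u$ is a norm on $Z$. $z\perp_B^{v_u}u$ means $v_u(z+\lambda u)\geq v_u(z)$ for all $\lambda\in\mathbb{K}$. A point $z$ of a normed space $E$ is smooth if the set of norm-one functionals $\phi\in E^*$ with $\phi(z)=\|z\|$ is a singleton; here $E=(Z,v_u)$, whose dual consists of the $v_u$-continuous linear functionals, with the dual norm of $v_u$. *)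

theory Defs
  imports "HOL-Analysis.Analysis"
begin

(* A scalar field that is R or C: isometrically isomorphic, as a normed field, to the
   subfield R of C or to C itself. *)
class real_or_complex = real_normed_field +
  assumes real_or_complex:
    "\<exists>h :: 'a \<Rightarrow> complex.
       (\<forall>x y. h (x + y) = h x + h y) \<and> (\<forall>x y. h (x * y) = h x * h y) \<and>
       (\<forall>r x. h (r *\<^sub>R x) = r *\<^sub>R h x) \<and> (\<forall>x. cmod (h x) = norm x) \<and>
       (range h = \<real> \<or> range h = UNIV)"

instance real :: real_or_complex
proof
  show "\<exists>h :: real \<Rightarrow> complex.
       (\<forall>x y. h (x + y) = h x + h y) \<and> (\<forall>x y. h (x * y) = h x * h y) \<and>
       (\<forall>r x. h (r *\<^sub>R x) = r *\<^sub>R h x) \<and> (\<forall>x. cmod (h x) = norm x) \<and>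
       (range h = \<real> \<or> range h = UNIV)"
    by (rule exI[of _ complex_of_real]) (auto simp: Reals_def scaleR_conv_of_real)
qed

instance complex :: real_or_complex
proof
  show "\<exists>h :: complex \<Rightarrow> complex.
       (\<forall>x y. h (x + y) = h x + h y) \<and> (\<forall>x y. h (x * y) = h x * h y) \<and>
       (\<forall>r x. h (r *\<^sub>R x) = r *\<^sub>R h x) \<and> (\<forall>x. cmod (h x) = norm x) \<and>
       (range h = \<real> \<or> range h = UNIV)"
    by (rule exI[of _ id]) auto
qed

(* The type class of 'a supplies the norm; completeness is 'a :: banach. *)
locale normed_space_over = vector_space smul
  for smul :: "'k::real_or_complex \<Rightarrow> 'a::real_normed_vector \<Rightarrow> 'a" +
  assumes smul_of_real: "smul (of_real r) x = r *\<^sub>R x"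
    and norm_smul: "norm (smul c x) = norm c * norm x"

definition is_norm :: "('k::real_or_complex \<Rightarrow> 'a::ab_group_add \<Rightarrow> 'a) \<Rightarrow> ('a \<Rightarrow> real) \<Rightarrow> bool" where
  "is_norm smul p \<longleftrightarrow>
     (\<forall>x. p x \<ge> 0) \<and> (\<forall>x. p x = 0 \<longleftrightarrow> x = 0) \<and>
     (\<forall>x y. p (x + y) \<le> p x + p y) \<and>
     (\<forall>c x. p (smul c x) = norm c * p x)"

(* The notions below refer to the space (Z, p) for a norm p which need not be the norm of
   the type; continuity is therefore spelled out with respect to p. *)
definition dual_space ::
    "('k::real_or_complex \<Rightarrow> 'a::ab_group_add \<Rightarrow> 'a) \<Rightarrow> ('a \<Rightarrow> real) \<Rightarrow> ('a \<Rightarrow> 'k) set" where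
  "dual_space smul p =
     {\<phi>. Vector_Spaces.linear smul (*) \<phi> \<and>
         (\<forall>x. \<forall>e>0. \<exists>d>0. \<forall>y. p (y - x) < d \<longrightarrow> norm (\<phi> y - \<phi> x) < e)}"

definition dual_norm :: "('a \<Rightarrow> real) \<Rightarrow> ('a \<Rightarrow> 'k::real_or_complex) \<Rightarrow> real" where
  "dual_norm p \<phi> = Sup {norm (\<phi> x) | x. p x \<le> 1}"

definition dual_sphere ::
    "('k::real_or_complex \<Rightarrow> 'a::ab_group_add \<Rightarrow> 'a) \<Rightarrow> ('a \<Rightarrow> real) \<Rightarrow> ('a \<Rightarrow> 'k) set" where
  "dual_sphere smul p = {\<phi> \<in> dual_space smul p. dual_norm p \<phi> = 1}"

lemma dual_space_norm:
  "dual_space smul norm = {\<phi>. Vector_Spaces.linear smul (*) \<phi> \<and> continuous_on UNIV \<phi>}"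
  by (simp add: dual_space_def continuous_on_iff dist_norm)

lemma dual_norm_norm:
  fixes \<phi> :: "'a::real_normed_vector \<Rightarrow> 'k::real_or_complex"
  assumes "bounded_linear \<phi>"
  shows "dual_norm norm \<phi> = onorm \<phi>"
  unfolding dual_norm_def
proof (rule cSup_eq_non_empty)
  show "{norm (\<phi> x) |x. norm x \<le> 1} \<noteq> {}"
    by (auto intro: exI[of _ 0])
  show "y \<le> onorm \<phi>" if "y \<in> {norm (\<phi> x) |x. norm x \<le> 1}" for y
  proof -
    from that obtain x where x: "y = norm (\<phi> x)" "norm x \<le> 1" by auto
    have "norm (\<phi> x) \<le> onorm \<phi> * norm x" by (rule onorm[OF assms])
    also have "\<dots> \<le> onorm \<phi> * 1"
      by (rule mult_left_mono[OF x(2) onorm_pos_le[OF assms]])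
    finally show ?thesis using x by simp
  qed
  show "onorm \<phi> \<le> b" if b: "\<And>y. y \<in> {norm (\<phi> x) |x. norm x \<le> 1} \<Longrightarrow> y \<le> b" for b
  proof (rule onorm_bound)
    interpret bounded_linear \<phi> by fact
    show "0 \<le> b"
      by (rule b) (auto intro!: exI[of _ 0] simp: zero)
    fix x
    show "norm (\<phi> x) \<le> b * norm x"
    proof (cases "x = 0")
      case False
      have "norm (\<phi> (inverse (norm x) *\<^sub>R x)) \<le> b"
        by (rule b) (use False in \<open>auto intro!: exI[of _ "inverse (norm x) *\<^sub>R x"]\<close>)
      then show ?thesis using False by (simp add: scaleR field_simps)
    qed (simp add: zero)
  qed
qed

definition numerical_radius ::
    "('k::real_or_complex \<Rightarrow> 'a::real_normed_vector \<Rightarrow> 'a) \<Rightarrow> 'a \<Rightarrow> 'a \<Rightarrow> real" where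
  "numerical_radius smul u z = Sup {norm (\<phi> z) | \<phi>. \<phi> \<in> dual_sphere smul norm \<and> \<phi> u = 1}"

definition vertex :: "('k::real_or_complex \<Rightarrow> 'a::real_normed_vector \<Rightarrow> 'a) \<Rightarrow> 'a \<Rightarrow> bool" where
  "vertex smul u \<longleftrightarrow> u \<in> sphere 0 1 \<and> is_norm smul (numerical_radius smul u)"

definition smooth_point ::
    "('k::real_or_complex \<Rightarrow> 'a::ab_group_add \<Rightarrow> 'a) \<Rightarrow> ('a \<Rightarrow> real) \<Rightarrow> 'a \<Rightarrow> bool" where
  "smooth_point smul p z \<longleftrightarrow> is_singleton {\<phi> \<in> dual_sphere smul p. \<phi> z = of_real (p z)}"

definition birkhoff_orthogonal ::
    "('k::real_or_complex \<Rightarrow> 'a::ab_group_add \<Rightarrow> 'a) \<Rightarrow> ('a \<Rightarrow> real) \<Rightarrow> 'a \<Rightarrow> 'a \<Rightarrow> bool" where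
  "birkhoff_orthogonal smul p z w \<longleftrightarrow> (\<forall>c. p (z + smul c w) \<ge> p z)"

end

theory Submission
  imports Defs
begin

text \<open>
  Every functional \<open>\<phi>\<close> of norm one with \<open>\<phi> u = 1\<close> satisfies \<open>\<bar>\<phi> (z + c u)\<bar> = \<bar>\<phi> z\<bar> + 1\<close> for a
  suitable unimodular \<open>c\<close>, so \<open>v\<^sub>u (z + c u) = v\<^sub>u z + 1\<close> for some unimodular \<open>c\<close>, because the unit
  circle is compact (this replaces the weak-* compactness of the face of \<open>u\<close>).
  A Hahn--Banach functional supporting \<open>v\<^sub>u\<close> at \<open>z + c u\<close> then supports \<open>v\<^sub>u\<close> at \<open>z\<close> and does not
  vanish at \<open>u\<close>. If \<open>z\<close> were Birkhoff--James orthogonal to \<open>u\<close>, then the quotient seminorm of \<open>v\<^sub>u\<close>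
  modulo the line through \<open>u\<close> would agree with \<open>v\<^sub>u\<close> at \<open>z\<close>, and a functional supporting the quotient seminorm
  at \<open>z\<close> would be a second support functional of \<open>v\<^sub>u\<close> at \<open>z\<close>, one that vanishes at \<open>u\<close>.
\<close>

section \<open>The Hahn--Banach theorem for sublinear functionals\<close>

text \<open>Homogeneity is stated as an inequality, so that infima are easy to check; equality for
  \<open>r > 0\<close> follows by scaling back with \<open>1 / r\<close>, and \<open>r = 0\<close>
  gives \<open>q 0 \<le> 0\<close>.\<close>

definition sublinear :: "('a::real_vector \<Rightarrow> real) \<Rightarrow> bool" where
  "sublinear q \<longleftrightarrow> (\<forall>x y. q (x + y) \<le> q x + q y) \<and> (\<forall>r\<ge>0. \<forall>x. q (r *\<^sub>R x) \<le> r * q x)"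

lemma sublinear_add: "sublinear q \<Longrightarrow> q (x + y) \<le> q x + q y"
  and sublinear_scale_le: "sublinear q \<Longrightarrow> 0 \<le> r \<Longrightarrow> q (r *\<^sub>R x) \<le> r * q x"
  by (auto simp: sublinear_def)

lemma sublinear_zero: "sublinear q \<Longrightarrow> q 0 = 0"
  using sublinear_add[of q 0 0] sublinear_scale_le[of q 0 0] by auto

lemma sublinear_scale:
  assumes "sublinear q" "0 \<le> r"
  shows "q (r *\<^sub>R x) = r * q x"
proof (cases "r = 0")
  case True
  then show ?thesis using sublinear_zero[OF assms(1)] by simp
next
  case False
  then have r: "r > 0" using assms(2) by simp
  have "q ((1 / r) *\<^sub>R (r *\<^sub>R x)) \<le> (1 / r) * q (r *\<^sub>R x)"
    using r by (intro sublinear_scale_le[OF assms(1)]) simp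
  then have "r * q x \<le> q (r *\<^sub>R x)"
    using r by (simp add: field_simps)
  then show ?thesis using sublinear_scale_le[OF assms] by (metis antisym)
qed

lemma sublinear_minus_ge: "sublinear q \<Longrightarrow> - q (- x) \<le> q x"
  using sublinear_add[of q x "- x"] sublinear_zero[of q] by simp

text \<open>The classical lowering step in the proof of Hahn-Banach: at \<open>- y\<close> the
  choice \<open>t = 1\<close> gives at most \<open>- q y\<close>, so any linear functional below
  \<open>tighten q y\<close> has value at least \<open>q y\<close> at \<open>y\<close>.\<close>

definition tighten :: "('a::real_vector \<Rightarrow> real) \<Rightarrow> 'a \<Rightarrow> 'a \<Rightarrow> real" where
  "tighten q y x = (INF t\<in>{0..}. q (x + t *\<^sub>R y) - t * q y)"

lemma tighten_le:
  assumes q: "sublinear q" and t: "0 \<le> t"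
  shows "tighten q y x \<le> q (x + t *\<^sub>R y) - t * q y"
  unfolding tighten_def
proof (rule cINF_lower)
  \<comment> \<open>Subadditivity for \<open>s y = (x + s y) + (- x)\<close> bounds the family below
    uniformly in \<open>s\<close>, so the infimum is a genuine one.\<close>
  have "- q (- x) \<le> q (x + s *\<^sub>R y) - s * q y" if "0 \<le> s" for s
    using sublinear_add[OF q, of "x + s *\<^sub>R y" "- x"] sublinear_scale[OF q that, of y]
    by simp
  then show "bdd_below ((\<lambda>s. q (x + s *\<^sub>R y) - s * q y) ` {0..})"
    by (auto intro!: bdd_belowI2)
qed (use t in simp)

lemma tighten_greatest:
  assumes "\<And>t. 0 \<le> t \<Longrightarrow> m \<le> q (x + t *\<^sub>R y) - t * q y"
  shows "m \<le> tighten q y x"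
  unfolding tighten_def by (rule cINF_greatest) (use assms in auto)

lemma tighten_le_self: "sublinear q \<Longrightarrow> tighten q y x \<le> q x"
  using tighten_le[of q 0 y x] by simp

lemma sublinear_tighten:
  assumes q: "sublinear q"
  shows "sublinear (tighten q y)"
  unfolding sublinear_def
proof safe
  fix x x' :: 'a
  have sum: "tighten q y (x + x') \<le> (q (x + s *\<^sub>R y) - s * q y) + (q (x' + t *\<^sub>R y) - t * q y)"
    if "0 \<le> s" "0 \<le> t" for s t
    using tighten_le[OF q, of "s + t" y "x + x'"] that
      sublinear_add[OF q, of "x + s *\<^sub>R y" "x' + t *\<^sub>R y"]
    by (simp add: algebra_simps)
  \<comment> \<open>The bound \<open>sum\<close> holds for independent \<open>s\<close> and
    \<open>t\<close>; the infimum is taken over \<open>s\<close> first and over \<open>t\<close>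
    afterwards.\<close>
  have "tighten q y (x + x') - (q (x' + t *\<^sub>R y) - t * q y) \<le> tighten q y x" if "0 \<le> t" for t
    by (rule tighten_greatest) (use sum that in \<open>force simp: algebra_simps\<close>)
  then have "tighten q y (x + x') - tighten q y x \<le> tighten q y x'"
    by (intro tighten_greatest) (force simp: algebra_simps)
  then show "tighten q y (x + x') \<le> tighten q y x + tighten q y x'" by simp
next
  fix r :: real and x :: 'a
  assume r: "0 \<le> r"
  show "tighten q y (r *\<^sub>R x) \<le> r * tighten q y x"
  proof (cases "r = 0")
    case True
    then show ?thesis using tighten_le_self[OF q, of y 0] sublinear_zero[OF q] by simp
  next
    case False
    with r have r: "r > 0" by simp
    have "tighten q y (r *\<^sub>R x) / r \<le> tighten q y x"
    proof (rule tighten_greatest)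
      fix t :: real assume t: "0 \<le> t"
      have "tighten q y (r *\<^sub>R x) \<le> q (r *\<^sub>R x + (r * t) *\<^sub>R y) - (r * t) * q y"
        using r t by (intro tighten_le[OF q]) simp
      also have "r *\<^sub>R x + (r * t) *\<^sub>R y = r *\<^sub>R (x + t *\<^sub>R y)"
        by (simp add: algebra_simps)
      also have "q \<dots> - (r * t) * q y = r * (q (x + t *\<^sub>R y) - t * q y)"
        using r by (simp only: sublinear_scale[OF q less_imp_le[OF r]]) (simp add: algebra_simps)
      finally show "tighten q y (r *\<^sub>R x) / r \<le> q (x + t *\<^sub>R y) - t * q y"
        using r by (simp add: field_simps)
    qed
    then show ?thesis using r by (simp add: field_simps)
  qed
qed

text \<open>Zorn's lemma for the pointwise order: a nonempty chain has its pointwise infimum as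
  lower bound, which stays sublinear because members of a chain are comparable.\<close>

lemma exists_minimal_sublinear:
  fixes p :: "'a::real_vector \<Rightarrow> real"
  assumes p: "sublinear p"
  obtains f where "sublinear f" "f \<le> p" "\<And>q. sublinear q \<Longrightarrow> q \<le> f \<Longrightarrow> q = f"
proof -
  define A where "A = {q. sublinear q \<and> q \<le> p}"
  have "\<exists>m\<in>A. \<forall>a\<in>A. m \<ge> a \<longrightarrow> a = m"
  proof (rule predicate_Zorn)
    show "partial_order_on A (relation_of (\<ge>) A)"
      by (rule partial_order_on_relation_ofI) auto
    fix C assume "C \<in> Chains (relation_of (\<ge>) A)"
    then have C: "\<And>q. q \<in> C \<Longrightarrow> sublinear q" "\<And>q. q \<in> C \<Longrightarrow> q \<le> p"
      and tot: "\<And>q q'. q \<in> C \<Longrightarrow> q' \<in> C \<Longrightarrow> q \<le> q' \<or> q' \<le> q"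
      by (auto simp: Chains_def relation_of_def A_def)
    show "\<exists>l\<in>A. \<forall>q\<in>C. q \<ge> l"
    proof (cases "C = {}")
      case True
      then show ?thesis using p by (auto simp: A_def)
    next
      case False
      define l where "l x = (INF q\<in>C. q x)" for x
      \<comment> \<open>This lower bound does not depend on \<open>q\<close>, so the infimum
        defining \<open>l\<close> is finite.\<close>
      have "- p (- x) \<le> q x" if "q \<in> C" for q x
        using sublinear_minus_ge[OF C(1)[OF that], of x] le_funD[OF C(2)[OF that], of "- x"]
        by simp
      then have le: "l x \<le> q x" if "q \<in> C" for q x
        unfolding l_def using that by (intro cINF_lower bdd_belowI2)
      have greatest: "m \<le> l x" if "\<And>q. q \<in> C \<Longrightarrow> m \<le> q x" for m x
        unfolding l_def using False that by (intro cINF_greatest)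
      \<comment> \<open>The smaller of \<open>q\<close> and \<open>q'\<close> can serve in both
        summands.\<close>
      have sum: "l (x + y) \<le> q x + q' y" if "q \<in> C" "q' \<in> C" for q q' x y
        using tot[OF that]
      proof
        assume "q \<le> q'"
        then show ?thesis
          using le[OF that(1), of "x + y"] sublinear_add[OF C(1)[OF that(1)], of x y]
          by (auto dest: le_funD[of _ _ y])
      next
        assume "q' \<le> q"
        then show ?thesis
          using le[OF that(2), of "x + y"] sublinear_add[OF C(1)[OF that(2)], of x y]
          by (auto dest: le_funD[of _ _ x])
      qed
      have "l (x + y) - q y \<le> l x" if "q \<in> C" for q x y
        by (rule greatest) (use sum that in \<open>force simp: algebra_simps\<close>)
      then have "l (x + y) - l x \<le> l y" for x y
        by (intro greatest) (force simp: algebra_simps)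
      moreover have "l (r *\<^sub>R x) \<le> r * l x" if r: "0 \<le> r" for r x
      proof (cases "r = 0")
        case True
        obtain q where "q \<in> C" using False by blast
        then show ?thesis using le[of q 0] sublinear_zero[OF C(1)[of q]] True by simp
      next
        case False
        with r have r: "r > 0" by simp
        have "l (r *\<^sub>R x) / r \<le> l x"
          using le[of _ "r *\<^sub>R x"] sublinear_scale[OF C(1), of _ r x] r
          by (intro greatest) (force simp: field_simps)
        then show ?thesis using r by (simp add: field_simps)
      qed
      ultimately have "sublinear l"
        by (simp add: sublinear_def algebra_simps)
      moreover have "l \<le> p"
        using False le C(2) by (metis all_not_in_conv le_funI order_trans)
      ultimately show ?thesis using le by (auto simp: A_def le_fun_def)
    qed
  qed
  then obtain f where "f \<in> A" "\<And>q. q \<in> A \<Longrightarrow> q \<le> f \<Longrightarrow> q = f" by blast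
  then show ?thesis
    by (intro that[of f]) (auto simp: A_def intro: order_trans)
qed

text \<open>A minimal sublinear functional is linear. Minimising below \<open>tighten p w\<close>
  rather than \<open>p\<close> gives \<open>f (- w) \<le> - p w\<close>, which forces
  \<open>f w = p w\<close>.\<close>

lemma sublinear_support:
  fixes p :: "'a::real_vector \<Rightarrow> real"
  assumes p: "sublinear p"
  obtains f where "linear f" "\<And>x. f x \<le> p x" "f w = p w"
proof -
  obtain f where f: "sublinear f" "f \<le> tighten p w"
    and min: "\<And>q. sublinear q \<Longrightarrow> q \<le> f \<Longrightarrow> q = f"
    using exists_minimal_sublinear[OF sublinear_tighten[OF p]] by blast
  \<comment> \<open>Minimality makes \<open>f\<close> a fixed point of every tightening; with
    \<open>t = 1\<close> this reads \<open>f x \<le> f (x + y) - f y\<close>, the missing half of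
    additivity.\<close>
  have fixed: "tighten f y = f" for y
    by (intro min sublinear_tighten f) (auto simp: le_fun_def tighten_le_self[OF f(1)])
  have add: "f (x + y) = f x + f y" for x y
    using tighten_le[OF f(1), of 1 y x] sublinear_add[OF f(1), of x y] by (simp add: fixed)
  have minus: "f (- x) = - f x" for x
    using add[of x "- x"] sublinear_zero[OF f(1)] by simp
  have "f (r *\<^sub>R x) = r * f x" for r x
    using sublinear_scale[OF f(1), of r x] sublinear_scale[OF f(1), of "- r" x] minus[of "r *\<^sub>R x"]
    by (cases "0 \<le> r") auto
  then have "linear f" using add by (auto intro: linearI)
  moreover have le: "f x \<le> p x" for x
    using le_funD[OF f(2), of x] tighten_le_self[OF p, of w x] by simp
  moreover have "f (- w) \<le> - p w"
    using le_funD[OF f(2), of "- w"] tighten_le[OF p, of 1 w "- w"] sublinear_zero[OF p] by simp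
  then have "f w = p w" using le[of w] minus[of w] by simp
  ultimately show ?thesis using that by blast
qed

section \<open>Support functionals over the real or complex field\<close>

text \<open>\<open>R\<close> is the real part, and \<open>j\<close> is the imaginary unit, with \<open>j = 0\<close> over the reals.\<close>

lemma real_or_complex_cases:
  obtains R :: "'k::real_or_complex \<Rightarrow> real" and j :: 'k
  where "linear R" "\<And>r. R (of_real r) = r" "R j = 0"
    and "\<And>c. R c \<le> norm c" "\<And>c. norm c \<le> R c \<Longrightarrow> c = of_real (norm c)"
    and "j = 0 \<or> j * j = - 1"
    and "\<And>c. \<exists>a b. c = of_real a + of_real b * j"
proof -
  obtain h :: "'k \<Rightarrow> complex" where
    add: "\<And>x y. h (x + y) = h x + h y" and mult: "\<And>x y. h (x * y) = h x * h y" and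
    scale: "\<And>r x. h (r *\<^sub>R x) = r *\<^sub>R h x" and norm: "\<And>x. cmod (h x) = norm x" and
    range: "range h = \<real> \<or> range h = UNIV"
    using real_or_complex by blast
  interpret h: linear h by (rule linearI) (rule add scale)+
  have inj: "x = y" if "h x = h y" for x y
    using that norm[of "x - y"] h.diff[of x y] by simp
  have one: "h 1 = 1"
  proof -
    have "h 1 * h 1 = h 1" "h 1 \<noteq> 0"
      using mult[of 1 1] norm[of 1] by auto
    then show ?thesis by simp
  qed
  have of_real: "h (of_real r) = of_real r" for r
    by (simp add: of_real_def scale one)
  have lin: "linear (\<lambda>c. Re (h c))"
    by (rule linearI) (simp_all add: add scale)
  have Re_le: "Re (h c) \<le> norm c" for c
    using complex_Re_le_cmod[of "h c"] by (simp add: norm)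
  have norm_Re: "c = of_real (norm c)" if "norm c \<le> Re (h c)" for c
  proof (rule inj)
    \<comment> \<open>When the real part reaches the modulus, the imaginary part vanishes.\<close>
    have "h c = of_real (cmod (h c))"
      using that complex_Re_le_cmod[of "h c"] cmod_power2[of "h c"] norm[of c]
      by (auto simp: complex_eq_iff)
    then show "h c = h (of_real (norm c))" by (simp add: norm of_real)
  qed
  show ?thesis
    using range
  proof
    assume R: "range h = \<real>"
    have "c = of_real (Re (h c))" for c
    proof (rule inj)
      have "h c \<in> \<real>" using R by blast
      then show "h c = h (of_real (Re (h c)))" by (simp add: of_real)
    qed
    then show ?thesis
      by (intro that[of "\<lambda>c. Re (h c)" 0])
        (auto simp: of_real h.zero intro: lin Re_le norm_Re)
  next
    assume U: "range h = UNIV"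
    then obtain j where j: "h j = \<i>" by (metis UNIV_I imageE)
    have "j * j = - 1" by (rule inj) (simp add: mult j h.neg one)
    moreover have "c = of_real (Re (h c)) + of_real (Im (h c)) * j" for c
      by (rule inj) (simp add: add mult of_real j complex_eq_iff)
    ultimately show ?thesis
      by (intro that[of "\<lambda>c. Re (h c)" j]) (auto simp: of_real j intro: lin Re_le norm_Re)
  qed
qed

text \<open>Compactness is pulled back along the isometry \<open>h\<close>: its range is closed, so
  the image of the sphere is compact in the complex plane, and the inverse of \<open>h\<close> is
  continuous there.\<close>

lemma compact_unit_sphere_scalar: "compact (sphere 0 1 :: 'k::real_or_complex set)"
proof -
  obtain h :: "'k \<Rightarrow> complex" where
    add: "\<And>x y. h (x + y) = h x + h y" and
    scale: "\<And>r x. h (r *\<^sub>R x) = r *\<^sub>R h x" and norm: "\<And>x. cmod (h x) = norm x" and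
    range: "range h = \<real> \<or> range h = UNIV"
    using real_or_complex by blast
  interpret h: linear h by (rule linearI) (rule add scale)+
  have dist: "dist (h x) (h y) = dist x y" for x y
    by (metis dist_norm h.diff norm)
  have inj: "inj h" by (rule injI) (metis dist dist_eq_0_iff)
  have "h ` sphere 0 1 = sphere 0 1 \<inter> range h"
    using norm by (auto simp: image_iff)
  moreover have "closed (range h)" using range closed_complex_Reals by auto
  ultimately have "compact (h ` sphere 0 1)"
    by (simp add: compact_Int_closed)
  moreover have "continuous_on (h ` sphere 0 1) (inv h)"
    unfolding continuous_on_iff by (auto simp: inv_f_f[OF inj] dist)
  ultimately have "compact (inv h ` h ` sphere 0 1)"
    by (rule compact_continuous_image[rotated])
  then show ?thesis by (simp add: image_image inv_f_f[OF inj])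
qed

lemma unimodular_rotation:
  fixes a :: "'k::real_normed_field"
  obtains c where "norm c = 1" "c * a = of_real (norm a)"
proof (cases "a = 0")
  case True
  then show ?thesis by (intro that[of 1]) auto
next
  case False
  then show ?thesis by (intro that[of "of_real (norm a) / a"]) (auto simp: norm_divide)
qed

section \<open>Seminorms over the scalar field, their support functionals, and the quotient by a
  line\<close>

definition is_seminorm :: "('k::real_or_complex \<Rightarrow> 'a::ab_group_add \<Rightarrow> 'a) \<Rightarrow> ('a \<Rightarrow> real) \<Rightarrow> bool" where
  "is_seminorm smul p \<longleftrightarrow>
     (\<forall>x y. p (x + y) \<le> p x + p y) \<and> (\<forall>c x. p (smul c x) = norm c * p x)"

lemma is_norm_imp_is_seminorm: "is_norm smul p \<Longrightarrow> is_seminorm smul p"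
  by (auto simp: is_norm_def is_seminorm_def)

context normed_space_over
begin

lemma scaleR_eq_smul: "r *\<^sub>R x = smul (of_real r) x"
  by (simp add: smul_of_real)

lemma is_norm_norm: "is_norm smul norm"
  by (auto simp: is_norm_def norm_smul norm_triangle_ineq)

lemma seminorm_nonneg:
  assumes "is_seminorm smul p"
  shows "0 \<le> p x"
proof -
  have "p (x + smul (- 1) x) \<le> p x + p (smul (- 1) x)" "p (smul 0 x) = 0" "p (smul (- 1) x) = p x"
    using assms unfolding is_seminorm_def by (metis, metis mult_zero_left norm_zero,
        metis mult_1 norm_minus_cancel norm_one)
  then show ?thesis by simp
qed

text \<open>The Bohnenblust-Sobczyk argument: a real support functional \<open>f\<close> is turned
  into a scalar-valued one with real part \<open>f\<close>, and rotation carries the bound on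
  \<open>f\<close> over to the norm.\<close>

lemma seminorm_support:
  assumes p: "is_seminorm smul p"
  obtains \<psi> where "Vector_Spaces.linear smul (*) \<psi>" "\<And>x. norm (\<psi> x) \<le> p x"
    "\<psi> w = of_real (p w)"
proof -
  obtain R :: "'k \<Rightarrow> real" and j where R: "linear R" "\<And>r. R (of_real r) = r" "R j = 0"
    and norm_R: "\<And>c. norm c \<le> R c \<Longrightarrow> c = of_real (norm c)"
    and j: "j = 0 \<or> j * j = - 1"
    and scalar: "\<And>c. \<exists>a b. c = of_real a + of_real b * j"
    by (rule real_or_complex_cases) blast
  interpret R: linear R by (rule R)
  have "sublinear p"
    using p by (auto simp: sublinear_def is_seminorm_def scaleR_eq_smul)
  then obtain f where f: "linear f" "\<And>x. f x \<le> p x" "f w = p w"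
    by (rule sublinear_support) blast
  interpret f: linear f by (rule f)
  \<comment> \<open>The usual complexification; for \<open>j = 0\<close> the second term vanishes
    and \<open>\<psi>\<close> is just \<open>f\<close>, so both fields are treated at once.\<close>
  define \<psi> where "\<psi> x = of_real (f x) - of_real (f (smul j x)) * j" for x
  have add: "\<psi> (x + y) = \<psi> x + \<psi> y" for x y
    by (simp add: \<psi>_def scale_right_distrib f.add algebra_simps)
  have real: "\<psi> (smul (of_real r) x) = of_real r * \<psi> x" for r x
  proof -
    have "smul j (smul (of_real r) x) = smul (of_real r) (smul j x)"
      by (simp add: mult.commute)
    then show ?thesis
      by (simp only: \<psi>_def smul_of_real f.scale) (simp add: algebra_simps)
  qed
  have imag: "\<psi> (smul j x) = j * \<psi> x" for x
    using j by (auto simp: \<psi>_def f.neg f.zero right_diff_distrib mult.left_commute[of j])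
  have scale: "\<psi> (smul c x) = c * \<psi> x" for c x
  proof -
    obtain a b where c: "c = of_real a + of_real b * j" using scalar by blast
    have "smul c x = smul (of_real a) x + smul (of_real b) (smul j x)"
      by (simp add: c scale_left_distrib)
    then show ?thesis by (simp only: add real imag c) (simp add: algebra_simps)
  qed
  have lin: "Vector_Spaces.linear smul (*) \<psi>"
    unfolding Vector_Spaces.linear_iff
    using add scale vector_space_axioms by (auto intro: vector_space.intro simp: algebra_simps)
  have R\<psi>: "R (\<psi> x) = f x" for x
  proof -
    have "\<psi> x = of_real (f x) - f (smul j x) *\<^sub>R j"
      by (simp add: \<psi>_def scaleR_conv_of_real)
    then show ?thesis by (simp add: R.diff R.scale R)
  qed
  have bound: "norm (\<psi> x) \<le> p x" for x
  proof -
    obtain c where c: "norm c = 1" "c * \<psi> x = of_real (norm (\<psi> x))"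
      by (rule unimodular_rotation)
    have "norm (\<psi> x) = f (smul c x)"
      by (simp add: R\<psi>[symmetric] scale c R)
    also have "f (smul c x) \<le> p (smul c x)" by (rule f)
    finally show ?thesis using p c by (simp add: is_seminorm_def)
  qed
  \<comment> \<open>At \<open>w\<close> the real part \<open>f w = p w\<close> already reaches the
    bound on the norm, so \<open>\<psi> w\<close> is a nonnegative real.\<close>
  have "norm (\<psi> w) \<le> R (\<psi> w)" by (simp add: R\<psi> f bound)
  then have "\<psi> w = of_real (norm (\<psi> w))" by (rule norm_R)
  moreover from this have "norm (\<psi> w) = p w"
    by (metis R(2) R\<psi> f(3))
  ultimately have "\<psi> w = of_real (p w)" by simp
  with lin bound show ?thesis by (rule that)
qed

text \<open>This is the quotient seminorm modulo the line through \<open>u\<close>, pulled back to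
  the whole space.\<close>

lemma is_seminorm_quotient:
  assumes p: "is_seminorm smul p"
  shows "is_seminorm smul (\<lambda>x. INF c. p (x + smul c u))"
proof -
  define Q where "Q x = (INF c. p (x + smul c u))" for x
  note nonneg = seminorm_nonneg[OF p]
  have add: "p (x + y) \<le> p x + p y" and scale: "p (smul c x) = norm c * p x" for c x y
    using p by (auto simp: is_seminorm_def)
  have le: "Q x \<le> p (x + smul c u)" for c x
    unfolding Q_def by (rule cINF_lower) (auto intro: bdd_belowI2 nonneg)
  have greatest: "m \<le> Q x" if "\<And>c. m \<le> p (x + smul c u)" for m x
    unfolding Q_def by (rule cINF_greatest) (use that in auto)
  have sum: "Q (x + y) \<le> p (x + smul c u) + p (y + smul d u)" for x y c d
    using le[of "x + y" "c + d"] add[of "x + smul c u" "y + smul d u"]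
    by (simp add: scale_left_distrib add_ac)
  have "Q (x + y) - p (y + smul d u) \<le> Q x" for x y d
    by (rule greatest) (use sum in \<open>force simp: algebra_simps\<close>)
  then have "Q (x + y) - Q x \<le> Q y" for x y
    by (intro greatest) (force simp: algebra_simps)
  then have Qadd: "Q (x + y) \<le> Q x + Q y" for x y by (simp add: algebra_simps)
  have Q0: "Q 0 = 0"
    using le[of 0 0] greatest[of 0 0] nonneg scale[of 0 0] by (force intro: antisym)
  \<comment> \<open>For \<open>c \<noteq> 0\<close> the substitution of \<open>c * d\<close> for
    \<open>d\<close> reindexes the infimum; the reverse inequality is the same one for
    \<open>inverse c\<close>.\<close>
  have Qle: "Q (smul c x) \<le> norm c * Q x" if c: "c \<noteq> 0" for c x
  proof -
    have "Q (smul c x) / norm c \<le> Q x"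
    proof (rule greatest)
      fix d
      have "Q (smul c x) \<le> p (smul c x + smul (c * d) u)" by (rule le)
      also have "smul c x + smul (c * d) u = smul c (x + smul d u)"
        by (simp add: scale_right_distrib)
      finally have "Q (smul c x) \<le> norm c * p (x + smul d u)" by (simp only: scale)
      then show "Q (smul c x) / norm c \<le> p (x + smul d u)"
        using c by (simp add: divide_le_eq mult.commute)
    qed
    then show ?thesis using c by (simp add: field_simps)
  qed
  have "Q (smul c x) = norm c * Q x" for c x
  proof (cases "c = 0")
    case True
    then show ?thesis by (simp add: Q0)
  next
    case False
    then have "Q x \<le> inverse (norm c) * Q (smul c x)"
      using Qle[of "inverse c" "smul c x"] by (simp add: norm_inverse)
    then show ?thesis using Qle[OF False, of x] False by (simp add: field_simps)
  qed
  with Qadd show ?thesis by (simp add: is_seminorm_def Q_def[symmetric])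
qed

section \<open>The dual sphere\<close>

text \<open>Domination by \<open>p\<close> gives continuity and dual norm at most one; normalising
  \<open>w\<close> to \<open>p\<close>-norm one shows that the value one is attained.\<close>

lemma dual_sphereI:
  assumes p: "is_norm smul p" and lin: "Vector_Spaces.linear smul (*) \<psi>"
    and bound: "\<And>x. norm (\<psi> x) \<le> p x" and w: "w \<noteq> 0" "norm (\<psi> w) = p w"
  shows "\<psi> \<in> dual_sphere smul p"
proof -
  interpret \<psi>: Vector_Spaces.linear smul "(*)" \<psi> by (rule lin)
  have scale: "p (smul c x) = norm c * p x" for c x using p by (simp add: is_norm_def)
  have pw: "p w > 0" using p w(1) by (auto simp: is_norm_def less_le)
  have "norm (\<psi> y - \<psi> x) \<le> p (y - x)" for x y
    using bound[of "y - x"] by (simp add: \<psi>.diff)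
  then have "\<psi> \<in> dual_space smul p"
    using lin unfolding dual_space_def by (auto intro: le_less_trans)
  moreover have "dual_norm p \<psi> = 1"
    unfolding dual_norm_def
  proof (rule cSup_eq_maximum)
    define y where "y = smul (of_real (inverse (p w))) w"
    have "norm (\<psi> y) = 1" "p y \<le> 1"
      using pw w by (auto simp: y_def \<psi>.scale scale norm_mult simp del: of_real_inverse)
    then show "1 \<in> {norm (\<psi> x) |x. p x \<le> 1}" by (metis (mono_tags, lifting) mem_Collect_eq)
  qed (use bound order_trans in blast)
  ultimately show ?thesis by (simp add: dual_sphere_def)
qed

text \<open>Continuity at \<open>0\<close> makes the set under the supremum in
  \<open>dual_norm\<close> bounded, so that \<open>dual_norm p \<phi> = 1\<close> bounds
  \<open>\<phi>\<close> on the unit ball; rescaling does the rest.\<close>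

lemma dual_sphere_le:
  assumes p: "is_norm smul p" and \<phi>: "\<phi> \<in> dual_sphere smul p"
  shows "norm (\<phi> x) \<le> p x"
proof -
  have lin: "Vector_Spaces.linear smul (*) \<phi>"
    and cont: "\<And>x e. e > 0 \<Longrightarrow> \<exists>d>0. \<forall>y. p (y - x) < d \<longrightarrow> norm (\<phi> y - \<phi> x) < e"
    and one: "dual_norm p \<phi> = 1"
    using \<phi> by (auto simp: dual_sphere_def dual_space_def)
  interpret \<phi>: Vector_Spaces.linear smul "(*)" \<phi> by (rule lin)
  have scale: "p (smul c x) = norm c * p x" for c x using p by (simp add: is_norm_def)
  obtain d where d: "d > 0" "\<And>y. p y < d \<Longrightarrow> norm (\<phi> y) < 1"
    using cont[of 1 0] by (auto simp: \<phi>.zero)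
  \<comment> \<open>Scaling by \<open>d / 2\<close> moves the closed unit ball strictly inside the
    \<open>d\<close>-ball, where \<open>\<phi>\<close> is below one.\<close>
  have "norm (\<phi> y) \<le> 2 / d" if "p y \<le> 1" for y
  proof -
    have "p (smul (of_real (d / 2)) y) \<le> d / 2"
      using that d by (simp add: scale del: of_real_divide)
    then have "norm (\<phi> (smul (of_real (d / 2)) y)) < 1"
      using d by (intro d(2)) simp
    then show ?thesis
      using d by (simp add: \<phi>.scale norm_mult field_simps del: of_real_divide)
  qed
  then have "bdd_above {norm (\<phi> y) |y. p y \<le> 1}" by (auto intro!: bdd_aboveI)
  then have le1: "norm (\<phi> y) \<le> 1" if "p y \<le> 1" for y
    using that one unfolding dual_norm_def by (metis (mono_tags, lifting) cSup_upper mem_Collect_eq)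
  show ?thesis
  proof (cases "x = 0")
    case True
    then show ?thesis using p by (simp add: \<phi>.zero is_norm_def)
  next
    case False
    then have px: "p x > 0" using p by (auto simp: is_norm_def less_le)
    then have "norm (\<phi> (smul (of_real (inverse (p x))) x)) \<le> 1"
      by (intro le1) (simp add: scale del: of_real_inverse)
    then show ?thesis
      using px by (simp add: \<phi>.scale norm_mult norm_inverse norm_divide field_simps)
  qed
qed

section \<open>Smooth points and Birkhoff-James orthogonality\<close>

lemma smooth_pointD:
  assumes "smooth_point smul p z"
    and "\<phi> \<in> dual_sphere smul p" "\<psi> \<in> dual_sphere smul p"
    and "\<phi> z = of_real (p z)" "\<psi> z = of_real (p z)"
  shows "\<phi> = \<psi>"
proof -
  obtain \<omega> where "{\<phi> \<in> dual_sphere smul p. \<phi> z = of_real (p z)} = {\<omega>}"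
    using assms(1) by (auto simp: smooth_point_def is_singleton_def)
  then have "\<phi> \<in> {\<omega>}" "\<psi> \<in> {\<omega>}" using assms(2-5) by blast+
  then show ?thesis by simp
qed

lemma smooth_point_support_unique:
  assumes p: "is_norm smul p" and smooth: "smooth_point smul p z"
    and \<phi>: "Vector_Spaces.linear smul (*) \<phi>" "\<And>x. norm (\<phi> x) \<le> p x" "\<phi> z = of_real (p z)"
    and \<psi>: "Vector_Spaces.linear smul (*) \<psi>" "\<And>x. norm (\<psi> x) \<le> p x" "\<psi> z = of_real (p z)"
    and z: "z \<noteq> 0"
  shows "\<phi> = \<psi>"
proof -
  have nz: "0 \<le> p z" using p by (simp add: is_norm_def)
  have "\<phi> \<in> dual_sphere smul p" "\<psi> \<in> dual_sphere smul p"
    using nz by (auto intro!: dual_sphereI[OF p _ _ z] simp: \<phi> \<psi>)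
  then show ?thesis
    using smooth_pointD[OF smooth] \<phi>(3) \<psi>(3) by blast
qed

text \<open>At \<open>0\<close> every element of the dual sphere is a support functional. A
  functional supporting \<open>p\<close> at \<open>u\<close> and its negative both lie there and
  differ at \<open>u\<close>.\<close>

lemma smooth_point_nonzero:
  fixes u :: 'a
  assumes p: "is_norm smul p" and smooth: "smooth_point smul p z" and u: "u \<noteq> 0"
  shows "z \<noteq> 0"
proof
  assume z: "z = 0"
  obtain \<psi> where \<psi>: "Vector_Spaces.linear smul (*) \<psi>" "\<And>x. norm (\<psi> x) \<le> p x"
    "\<psi> u = of_real (p u)"
    by (rule seminorm_support[OF is_norm_imp_is_seminorm[OF p]]) blast
  interpret \<psi>: Vector_Spaces.linear smul "(*)" \<psi> by (rule \<psi>)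
  have pu: "0 < p u" using p u by (auto simp: is_norm_def less_le)
  have p0: "p 0 = 0" using p by (simp add: is_norm_def)
  have "Vector_Spaces.linear smul (*) (\<lambda>x. - \<psi> x)"
    using \<psi>(1) unfolding Vector_Spaces.linear_iff by auto
  then have "(\<lambda>x. - \<psi> x) \<in> dual_sphere smul p"
    by (rule dual_sphereI[OF p _ _ u]) (use \<psi> pu in auto)
  moreover have "\<psi> \<in> dual_sphere smul p"
    by (rule dual_sphereI[OF p \<psi>(1) _ u]) (use \<psi> pu in auto)
  ultimately have "(\<lambda>x. - \<psi> x) = \<psi>"
    by (rule smooth_pointD[OF smooth]) (simp_all add: z p0 \<psi>.zero)
  then have "- \<psi> u = \<psi> u" by (rule fun_cong)
  then have "2 * \<psi> u = 0" by (simp add: minus_equation_iff eq_neg_iff_add_eq_0)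
  then show False using pu \<psi>(3) by simp
qed

lemma birkhoff_orthogonal_support:
  assumes p: "is_norm smul p" and orth: "birkhoff_orthogonal smul p z u"
  obtains \<psi> where "Vector_Spaces.linear smul (*) \<psi>" "\<And>x. norm (\<psi> x) \<le> p x"
    "\<psi> z = of_real (p z)" "\<psi> u = 0"
proof -
  define Q where "Q x = (INF c. p (x + smul c u))" for x
  have le: "Q x \<le> p (x + smul c u)" for c x
    unfolding Q_def by (rule cINF_lower) (use p in \<open>auto simp: is_norm_def intro: bdd_belowI2\<close>)
  have "is_seminorm smul Q"
    unfolding Q_def by (intro is_seminorm_quotient is_norm_imp_is_seminorm p)
  then obtain \<psi> where \<psi>: "Vector_Spaces.linear smul (*) \<psi>" "\<And>x. norm (\<psi> x) \<le> Q x"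
    "\<psi> z = of_real (Q z)"
    by (rule seminorm_support) blast
  \<comment> \<open>Orthogonality says exactly that \<open>p z\<close> is a lower bound of
    \<open>p\<close> on the coset of \<open>z\<close> modulo the line through
    \<open>u\<close>.\<close>
  have "p z \<le> Q z"
    unfolding Q_def by (rule cINF_greatest) (use orth in \<open>auto simp: birkhoff_orthogonal_def\<close>)
  then have "Q z = p z" using le[of z 0] by simp
  moreover have "norm (\<psi> x) \<le> p x" for x
    using \<psi>(2)[of x] le[of x 0] by simp
  moreover have "p 0 = 0" using p by (simp add: is_norm_def)
  then have "Q u \<le> 0" using le[of u "- 1"] by simp
  then have "norm (\<psi> u) \<le> 0" using \<psi>(2)[of u] by linarith
  then have "\<psi> u = 0" by simp
  ultimately show ?thesis using that[of \<psi>] \<psi> by simp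
qed

section \<open>The numerical radius\<close>

lemma numerical_radius_ge:
  assumes "\<phi> \<in> dual_sphere smul norm" "\<phi> u = 1"
  shows "norm (\<phi> x) \<le> numerical_radius smul u x"
  unfolding numerical_radius_def
proof (rule cSup_upper)
  show "bdd_above {norm (\<phi> x) |\<phi>. \<phi> \<in> dual_sphere smul norm \<and> \<phi> u = 1}"
    using dual_sphere_le[OF is_norm_norm] by (auto intro!: bdd_aboveI)
qed (use assms in auto)

lemma numerical_radius_le:
  assumes "\<exists>\<phi>\<in>dual_sphere smul norm. \<phi> u = 1"
    and "\<And>\<phi>. \<phi> \<in> dual_sphere smul norm \<Longrightarrow> \<phi> u = 1 \<Longrightarrow> norm (\<phi> x) \<le> b"
  shows "numerical_radius smul u x \<le> b"
  unfolding numerical_radius_def by (rule cSup_least) (use assms in auto)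

text \<open>Ensures that the supremum defining \<open>numerical_radius\<close> ranges over a
  nonempty set.\<close>

lemma exists_norming_functional:
  assumes "norm u = 1"
  shows "\<exists>\<phi>\<in>dual_sphere smul norm. \<phi> u = 1"
proof -
  obtain \<psi> where \<psi>: "Vector_Spaces.linear smul (*) \<psi>" "\<And>x. norm (\<psi> x) \<le> norm x"
    "\<psi> u = of_real (norm u)"
    by (rule seminorm_support[OF is_norm_imp_is_seminorm[OF is_norm_norm]]) blast
  then have "\<psi> \<in> dual_sphere smul norm"
    using assms by (intro dual_sphereI[OF is_norm_norm, of _ u]) auto
  with \<psi> assms show ?thesis by auto
qed

lemma numerical_radius_self:
  assumes "norm u = 1"
  shows "numerical_radius smul u u = 1"
proof (rule antisym)
  show "numerical_radius smul u u \<le> 1"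
    by (rule numerical_radius_le[OF exists_norming_functional[OF assms]]) simp
  show "1 \<le> numerical_radius smul u u"
    using exists_norming_functional[OF assms] numerical_radius_ge[of _ u u] by force
qed

text \<open>The rotation suited to a functional \<open>\<phi>\<close> depends on
  \<open>\<phi>\<close>. Choosing \<open>c\<close> to maximise the numerical radius of
  \<open>z + c u\<close> over the unit circle dominates all these rotations at once.\<close>

lemma numerical_radius_attained_rotation:
  assumes u: "norm u = 1" and v: "is_seminorm smul (numerical_radius smul u)"
  obtains c where "norm c = 1"
    "numerical_radius smul u z + 1 \<le> numerical_radius smul u (z + smul c u)"
proof -
  let ?v = "numerical_radius smul u"
  have add: "?v (x + y) \<le> ?v x + ?v y" and scale: "?v (smul c x) = norm c * ?v x" for c x y
    using v by (auto simp: is_seminorm_def)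
  \<comment> \<open>Since \<open>?v u = 1\<close>, the function to be maximised is 1-Lipschitz in
    the scalar.\<close>
  have lip: "?v (z + smul c u) \<le> ?v (z + smul d u) + norm (c - d)" for c d
    using add[of "z + smul d u" "smul (c - d) u"] scale[of "c - d" u] numerical_radius_self[OF u]
    by (simp add: scale_left_diff_distrib)
  have "dist (?v (z + smul c u)) (?v (z + smul d u)) \<le> dist c d" for c d
    using lip[of c d] lip[of d c] by (simp add: dist_real_def dist_norm norm_minus_commute abs_le_iff)
  then have "continuous_on (sphere 0 1) (\<lambda>c. ?v (z + smul c u))"
    unfolding continuous_on_iff by (meson le_less_trans)
  moreover have "sphere 0 1 \<noteq> ({} :: 'k set)"
    by (auto intro!: exI[of _ 1])
  ultimately obtain c where c: "norm c = 1"
    and max: "\<And>d. norm d = 1 \<Longrightarrow> ?v (z + smul d u) \<le> ?v (z + smul c u)"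
    using continuous_attains_sup[OF compact_unit_sphere_scalar] by (force simp: dist_norm)
  have "?v z \<le> ?v (z + smul c u) - 1"
  proof (rule numerical_radius_le[OF exists_norming_functional[OF u]])
    fix \<phi> assume \<phi>: "\<phi> \<in> dual_sphere smul norm" "\<phi> u = 1"
    then interpret \<phi>: Vector_Spaces.linear smul "(*)" \<phi>
      by (simp add: dual_sphere_def dual_space_def)
    obtain d where d: "norm d = 1" "d * \<phi> z = of_real (norm (\<phi> z))"
      by (rule unimodular_rotation)
    then have d0: "d \<noteq> 0" by auto
    \<comment> \<open>Multiplying by the unimodular \<open>d\<close> aligns both terms:
      \<open>d * \<phi> z\<close> becomes \<open>norm (\<phi> z)\<close>, and the term from
      \<open>u\<close> becomes \<open>1\<close>.\<close>
    have "norm (\<phi> (z + smul (inverse d) u)) = norm (d * \<phi> (z + smul (inverse d) u))"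
      by (simp add: norm_mult d)
    also have "d * \<phi> (z + smul (inverse d) u) = of_real (norm (\<phi> z) + 1)"
      using d d0 \<phi>(2) by (simp add: \<phi>.add \<phi>.scale distrib_left)
    also have "norm \<dots> = norm (\<phi> z) + 1" by (simp del: of_real_add)
    finally have "norm (\<phi> z) + 1 \<le> ?v (z + smul (inverse d) u)"
      using numerical_radius_ge[OF \<phi>, of "z + smul (inverse d) u"] by simp
    also have "\<dots> \<le> ?v (z + smul c u)"
      using d by (intro max) (simp add: norm_inverse)
    finally show "norm (\<phi> z) \<le> ?v (z + smul c u) - 1" by simp
  qed
  with c show ?thesis by (intro that[of c]) auto
qed

lemma numerical_radius_support_nonzero:
  assumes u: "norm u = 1" and v: "is_seminorm smul (numerical_radius smul u)"
  obtains \<psi> where "Vector_Spaces.linear smul (*) \<psi>"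
    "\<And>x. norm (\<psi> x) \<le> numerical_radius smul u x"
    "\<psi> z = of_real (numerical_radius smul u z)" "\<psi> u \<noteq> 0"
proof -
  let ?v = "numerical_radius smul u"
  obtain c where c: "norm c = 1" "?v z + 1 \<le> ?v (z + smul c u)"
    using numerical_radius_attained_rotation[OF u v] by blast
  obtain \<psi> where \<psi>: "Vector_Spaces.linear smul (*) \<psi>" "\<And>x. norm (\<psi> x) \<le> ?v x"
    "\<psi> (z + smul c u) = of_real (?v (z + smul c u))"
    by (rule seminorm_support[OF v]) blast
  interpret \<psi>: Vector_Spaces.linear smul "(*)" \<psi> by (rule \<psi>)
  obtain R :: "'k \<Rightarrow> real" where R: "linear R" "\<And>r. R (of_real r) = r"
    and R_le: "\<And>c. R c \<le> norm c"
    and norm_R: "\<And>c. norm c \<le> R c \<Longrightarrow> c = of_real (norm c)"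
    by (rule real_or_complex_cases) blast
  interpret R: linear R by (rule R)
  \<comment> \<open>The term from \<open>u\<close> contributes at most one to a value of at least
    \<open>?v z + 1\<close>, which leaves at least \<open>?v z\<close> for the real part of
    \<open>\<psi> z\<close>.\<close>
  have "norm (\<psi> (smul c u)) \<le> 1"
    using \<psi>(2)[of u] c(1) numerical_radius_self[OF u] by (simp add: \<psi>.scale norm_mult)
  then have "R (\<psi> (smul c u)) \<le> 1" using R_le order_trans by blast
  moreover have "R (\<psi> z) + R (\<psi> (smul c u)) = ?v (z + smul c u)"
    using \<psi>(3) by (metis R(2) R.add \<psi>.add)
  ultimately have R_ge: "?v z \<le> R (\<psi> z)" using c(2) by simp
  then have "\<psi> z = of_real (norm (\<psi> z))" using \<psi>(2)[of z] by (intro norm_R) simp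
  moreover have "norm (\<psi> z) = ?v z"
    using R_ge R_le[of "\<psi> z"] \<psi>(2)[of z] by simp
  ultimately have "\<psi> z = of_real (?v z)" by simp
  \<comment> \<open>Otherwise \<open>\<psi>\<close> would agree at \<open>z\<close> and
    \<open>z + c u\<close>, against the gap of one between the two numerical radii.\<close>
  moreover have "\<psi> u \<noteq> 0"
  proof
    assume "\<psi> u = 0"
    then have "\<psi> (z + smul c u) = \<psi> z" by (simp add: \<psi>.add \<psi>.scale)
    then have "?v (z + smul c u) = ?v z" using \<psi>(3) calculation by simp
    then show False using c(2) by simp
  qed
  ultimately show ?thesis using \<psi>(1,2) by (intro that)
qed

end

section \<open>Conclusion: two support functionals at \<open>z\<close> that differ at
  \<open>u\<close>\<close>

theorem theorem5p1:
  fixes smul :: "'k::real_or_complex \<Rightarrow> 'a::banach \<Rightarrow> 'a"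
    and u z :: 'a
  assumes "normed_space_over smul"
    and "u \<in> sphere 0 1"
    and "vertex smul u"
    and "smooth_point smul (numerical_radius smul u) z"
  shows "\<not> birkhoff_orthogonal smul (numerical_radius smul u) z u"
proof
  interpret normed_space_over smul by fact
  let ?v = "numerical_radius smul u"
  have u: "norm u = 1" and v: "is_norm smul ?v"
    using assms(3) by (auto simp: vertex_def)
  have "u \<noteq> 0" using u by auto
  then have z: "z \<noteq> 0" by (rule smooth_point_nonzero[OF v assms(4)])
  assume "birkhoff_orthogonal smul ?v z u"
  then obtain \<phi> where \<phi>: "Vector_Spaces.linear smul (*) \<phi>" "\<And>x. norm (\<phi> x) \<le> ?v x"
    "\<phi> z = of_real (?v z)" "\<phi> u = 0"
    by (rule birkhoff_orthogonal_support[OF v]) blast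
  obtain \<psi> where \<psi>: "Vector_Spaces.linear smul (*) \<psi>" "\<And>x. norm (\<psi> x) \<le> ?v x"
    "\<psi> z = of_real (?v z)" "\<psi> u \<noteq> 0"
    by (rule numerical_radius_support_nonzero[OF u is_norm_imp_is_seminorm[OF v]]) blast
  have "\<phi> = \<psi>"
    by (rule smooth_point_support_unique[OF v assms(4) \<phi>(1-3) \<psi>(1-3) z])
  with \<phi>(4) \<psi>(4) show False by simp
qed

end
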